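(* Let $\Phi=\{\phi_i\}_{i\in[n]}$ and $\Psi=\{\psi_i\}_{i\in[n]}$ be unitary equivalent frames for $\mathbb{C}^m$ with frame operators $S_\Phi$ and $S_\Psi$, respectively. Then for every $r\in[n-1]$, $$\rho^{(r)}_{\Phi,S_\Phi^{-1}\Phi}=\rho^{(r)}_{\Psi,S_\Psi^{-1}\Psi},$$ where $S_\Phi^{-1}\Phi=\{S_\Phi^{-1}\phi_i\}_{i\in[n]}$ and $S_\Psi^{-1}\Psi=\{S_\Psi^{-1}\psi_i\}_{i\in[n]}$ are the canonical dual frames.
   Context: $[n]=\{1,\dots,n\}$. A finite sequence $\Phi=\{\phi_i\}_{i\in[n]}$ in $\mathbb{C}^m$ is a frame for $\mathbb{C}^m$ if there are constants $0<A\le B$ with $A\|f\|^2\le\sum_{i\in[n]}|\langle f,\phi_i\rangle|^2\le B\|f\|^2$ for all $f\in\mathbb{C}^m$ (inner product linear in the first argument). Its frame operator is $S_\Phi f=\sum_{i\in[n]}\langle f,\phi_i\rangle\phi_i$, which is invertible. A frame $\Psi=\{\psi_i\}_{i\in[n]}$ for $\mathbb{C}^m$ is a dual frame of $\Phi$ if $f=\sum_{i\in[n]}\langle f,\phi_i\rangle\psi_i=\sum_{i\in[n]}\langle f,\psi_i\rangle\phi_i$ for all $f\in\mathbb{C}^m$; the canonical dual frame is $S_\Phi^{-1}\Phi=\{S_\Phi^{-1}\phi_i\}_{i\in[n]}$. Two frames $\{\phi_i\}_{i\in[n]}$ and $\{\psi_i\}_{i\in[n]}$ for $\mathbb{C}^m$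 are unitary equivalent if there is a unitary operator $V:\mathbb{C}^m\to\mathbb{C}^m$ with $V\phi_i=\psi_i$ for all $i\in[n]$. For a frame $\Phi$, a dual frame $\Psi$ of $\Phi$ and $\Lambda\subset[n]$, the error operator is $E_{\Phi,\Psi,\Lambda}:\mathbb{C}^m\to\mathbb{C}^m$, $E_{\Phi,\Psi,\Lambda}(f)=\sum_{i\in\Lambda}\langle f,\phi_i\rangle\psi_i$. For $1\le r<n$, $\rho^{(r)}_{\Phi,\Psi}=\max\{\rho(E_{\Phi,\Psi,\Lambda}):\Lambda\subset[n],\ |\Lambda|=r\}$, where $\rho(\cdot)$ denotes the spectral radius. *)

theory Defs
  imports "HOL-Analysis.Analysis"
begin

text \<open>
  The space C^m is \<open>complex ^ 'm\<close>. Its library norm is the Euclidean norm, but the library inner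
  product on it is real valued, so the Hermitian one, linear in the first argument, is defined here.
\<close>

definition cinner :: "complex ^ 'm \<Rightarrow> complex ^ 'm \<Rightarrow> complex" where
  "cinner x y = (\<Sum>k\<in>UNIV. x $ k * cnj (y $ k))"

lemma cinner_self: "cinner x x = of_real ((norm x)\<^sup>2)"
proof -
  have "(norm x)\<^sup>2 = (\<Sum>k\<in>UNIV. (cmod (x $ k))\<^sup>2)"
    by (simp add: norm_vec_def L2_set_def sum_nonneg)
  then show ?thesis
    by (simp only: cinner_def of_real_sum complex_norm_square)
qed

text \<open>
  A finite sequence indexed by \<open>{1..n}\<close> is a function on \<open>nat\<close>; its values outside \<open>{1..n}\<close> are
  never used.
\<close>

definition is_frame :: "nat \<Rightarrow> (nat \<Rightarrow> complex ^ 'm) \<Rightarrow> bool" where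
  "is_frame n \<phi> \<longleftrightarrow> (\<exists>A B :: real. 0 < A \<and> A \<le> B \<and>
     (\<forall>f. A * (norm f)\<^sup>2 \<le> (\<Sum>i\<in>{1..n}. (cmod (cinner f (\<phi> i)))\<^sup>2) \<and>
          (\<Sum>i\<in>{1..n}. (cmod (cinner f (\<phi> i)))\<^sup>2) \<le> B * (norm f)\<^sup>2))"

definition frame_op :: "nat \<Rightarrow> (nat \<Rightarrow> complex ^ 'm) \<Rightarrow> complex ^ 'm \<Rightarrow> complex ^ 'm" where
  "frame_op n \<phi> f = (\<Sum>i\<in>{1..n}. cinner f (\<phi> i) *s \<phi> i)"

definition canonical_dual :: "nat \<Rightarrow> (nat \<Rightarrow> complex ^ 'm) \<Rightarrow> nat \<Rightarrow> complex ^ 'm" where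
  "canonical_dual n \<phi> i = inv (frame_op n \<phi>) (\<phi> i)"

definition unitary_operator :: "(complex ^ 'm \<Rightarrow> complex ^ 'm) \<Rightarrow> bool" where
  "unitary_operator V \<longleftrightarrow> Vector_Spaces.linear (*s) (*s) V \<and> surj V \<and>
     (\<forall>x y. cinner (V x) (V y) = cinner x y)"

definition unitary_equivalent ::
  "nat \<Rightarrow> (nat \<Rightarrow> complex ^ 'm) \<Rightarrow> (nat \<Rightarrow> complex ^ 'm) \<Rightarrow> bool" where
  "unitary_equivalent n \<phi> \<psi> \<longleftrightarrow>
     (\<exists>V. unitary_operator V \<and> (\<forall>i\<in>{1..n}. V (\<phi> i) = \<psi> i))"

definition error_op ::
  "(nat \<Rightarrow> complex ^ 'm) \<Rightarrow> (nat \<Rightarrow> complex ^ 'm) \<Rightarrow> nat set \<Rightarrow> complex ^ 'm \<Rightarrow> complex ^ 'm" where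
  "error_op \<phi> \<psi> \<Lambda> f = (\<Sum>i\<in>\<Lambda>. cinner f (\<phi> i) *s \<psi> i)"

text \<open>
  Meant for linear operators: their eigenvalue set is finite and, the scalars being complex and
  the dimension positive, nonempty, so that the maximum exists.
\<close>

definition eigenvalues :: "(complex ^ 'm \<Rightarrow> complex ^ 'm) \<Rightarrow> complex set" where
  "eigenvalues T = {c. \<exists>v. v \<noteq> 0 \<and> T v = c *s v}"

definition spectral_radius :: "(complex ^ 'm \<Rightarrow> complex ^ 'm) \<Rightarrow> real" where
  "spectral_radius T = Max (cmod ` eigenvalues T)"

definition max_spectral_error ::
  "nat \<Rightarrow> nat \<Rightarrow> (nat \<Rightarrow> complex ^ 'm) \<Rightarrow> (nat \<Rightarrow> complex ^ 'm) \<Rightarrow> real" where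
  "max_spectral_error n r \<phi> \<psi> =
     Max ((\<lambda>\<Lambda>. spectral_radius (error_op \<phi> \<psi> \<Lambda>)) ` {\<Lambda>. \<Lambda> \<subseteq> {1..n} \<and> card \<Lambda> = r})"

end

theory Submission
  imports Defs
begin

text \<open>
  A unitary \<open>V\<close> with \<open>V \<phi>\<^sub>i = \<psi>\<^sub>i\<close> intertwines the frame operators, hence also their inverses, so it
  maps one canonical dual to the other. It therefore intertwines the error operators for every
  erasure set, and these are similar, with equal spectra.
\<close>

lemma cinner_scale_left: "cinner (c *s x) y = c * cinner x y"
  by (simp add: cinner_def sum_distrib_left mult.assoc)

lemma cinner_add_left: "cinner (x + y) z = cinner x z + cinner y z"
  by (simp add: cinner_def sum.distrib distrib_right)

lemma cinner_sum_left: "cinner (\<Sum>i\<in>I. f i) y = (\<Sum>i\<in>I. cinner (f i) y)"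
  by (simp add: cinner_def sum_component sum_distrib_right, subst sum.swap, rule refl)

lemma cnj_cinner: "cnj (cinner x y) = cinner y x"
  by (simp add: cinner_def mult.commute)

text \<open>Lets linearity and the intertwining with a unitary operator be proved once, for error
  operators, and then be reused for frame operators.\<close>

lemma frame_op_eq_error_op: "frame_op n \<phi> = error_op \<phi> \<phi> {1..n}"
  by (rule ext) (simp add: frame_op_def error_op_def)

lemma linear_error_op: "Vector_Spaces.linear (*s) (*s) (error_op \<phi> \<psi> \<Lambda>)"
  by unfold_locales
    (simp_all add: error_op_def cinner_add_left cinner_scale_left vec.scale_left_distrib
      sum.distrib vec.scale_sum_right)

text \<open>Links the frame operator to the quadratic form that the frame bounds control.\<close>

lemma cinner_frame_op_self:
  "cinner (frame_op n \<phi> f) f = of_real (\<Sum>i\<in>{1..n}. (cmod (cinner f (\<phi> i)))\<^sup>2)"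
proof -
  have "cinner f (\<phi> i) * cinner (\<phi> i) f = of_real ((cmod (cinner f (\<phi> i)))\<^sup>2)" for i
    by (simp only: complex_norm_square cnj_cinner)
  then show ?thesis
    by (simp add: frame_op_def cinner_sum_left cinner_scale_left)
qed

text \<open>The lower frame bound makes the kernel trivial, and in finite dimension an injective
  linear endomorphism is onto. This makes \<open>inv\<close> in \<open>canonical_dual\<close> a
  genuine two-sided inverse.\<close>

lemma bij_frame_op:
  assumes "is_frame n \<phi>"
  shows "bij (frame_op n \<phi>)"
proof -
  interpret S: Vector_Spaces.linear "(*s)" "(*s)" "frame_op n \<phi>"
    unfolding frame_op_eq_error_op by (rule linear_error_op)
  from assms obtain A where "0 < A"
    and A: "\<And>f. A * (norm f)\<^sup>2 \<le> (\<Sum>i\<in>{1..n}. (cmod (cinner f (\<phi> i)))\<^sup>2)"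
    unfolding is_frame_def by blast
  have "f = 0" if "frame_op n \<phi> f = 0" for f
  proof -
    have "(\<Sum>i\<in>{1..n}. (cmod (cinner f (\<phi> i)))\<^sup>2) = 0"
      using cinner_frame_op_self[of n \<phi> f] that
      by (metis cinner_scale_left mult_zero_left of_real_eq_0_iff vector_smult_lzero)
    with A[of f] \<open>0 < A\<close> show "f = 0"
      by (simp add: mult_le_0_iff)
  qed
  then have inj: "inj (frame_op n \<phi>)"
    by (simp add: S.inj_iff_eq_0)
  with vec.linear_injective_imp_surjective[OF S.linear_axioms inj] show ?thesis
    by (simp add: bij_def)
qed

lemma norm_unitary_operator: "norm (V x) = norm x" if "unitary_operator V"
proof -
  have "complex_of_real ((norm (V x))\<^sup>2) = of_real ((norm x)\<^sup>2)"
    using that by (metis cinner_self unitary_operator_def)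
  then show ?thesis
    by (simp only: of_real_eq_iff power2_eq_iff_nonneg norm_ge_zero)
qed

lemma bij_unitary_operator:
  assumes "unitary_operator V"
  shows "bij V"
proof -
  interpret V: Vector_Spaces.linear "(*s)" "(*s)" V
    using assms by (simp add: unitary_operator_def)
  have "inj V"
    by (metis V.inj_iff_eq_0 assms norm_eq_zero norm_unitary_operator)
  with assms show ?thesis
    by (simp add: bij_def unitary_operator_def)
qed

text \<open>By linearity \<open>V\<close> passes through the sum, and the coefficients stay the same
  because \<open>V\<close> preserves \<open>cinner\<close>. The two sequences are kept independent
  so that the lemma covers both a frame paired with itself and a frame paired with its canonical
  dual.\<close>

lemma error_op_unitary_operator:
  assumes "unitary_operator V"
    and "\<And>i. i \<in> \<Lambda> \<Longrightarrow> \<phi>' i = V (\<phi> i)"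
    and "\<And>i. i \<in> \<Lambda> \<Longrightarrow> \<psi>' i = V (\<psi> i)"
  shows "error_op \<phi>' \<psi>' \<Lambda> (V f) = V (error_op \<phi> \<psi> \<Lambda> f)"
proof -
  interpret V: Vector_Spaces.linear "(*s)" "(*s)" V
    using assms(1) by (simp add: unitary_operator_def)
  have "cinner (V x) (V y) = cinner x y" for x y
    using assms(1) by (simp add: unitary_operator_def)
  then show ?thesis
    by (simp add: error_op_def assms(2,3) V.sum V.scale)
qed

lemma canonical_dual_unitary_operator:
  assumes "is_frame n \<phi>" "is_frame n \<psi>" "unitary_operator V"
    and V: "\<And>i. i \<in> {1..n} \<Longrightarrow> \<psi> i = V (\<phi> i)" and i: "i \<in> {1..n}"
  shows "canonical_dual n \<psi> i = V (canonical_dual n \<phi> i)"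
proof -
  have "frame_op n \<psi> (V (canonical_dual n \<phi> i)) = V (frame_op n \<phi> (canonical_dual n \<phi> i))"
    unfolding frame_op_eq_error_op by (rule error_op_unitary_operator) (use assms in auto)
  also have "\<dots> = \<psi> i"
    using bij_frame_op[OF assms(1)] V[OF i]
    by (simp add: canonical_dual_def bij_is_surj surj_f_inv_f)
  \<comment> \<open>The frame operator of \<open>\<psi>\<close> sends
    \<open>V (canonical_dual n \<phi> i)\<close> to \<open>\<psi> i\<close>; its injectivity
    identifies that vector as the canonical dual vector.\<close>
  finally show ?thesis
    using bij_frame_op[OF assms(2)] by (metis bij_is_inj canonical_dual_def inv_f_f)
qed

text \<open>\<open>V\<close> carries eigenvectors of \<open>T\<close> to eigenvectors of
  \<open>T'\<close> with the same eigenvalue, and every eigenvector of \<open>T'\<close> arises in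
  this way.\<close>

lemma eigenvalues_similar:
  assumes "Vector_Spaces.linear (*s) (*s) V" and "bij V"
    and TV: "\<And>f. T' (V f) = V (T f)"
  shows "eigenvalues T' = eigenvalues T"
proof -
  interpret V: Vector_Spaces.linear "(*s)" "(*s)" V by fact
  have inj: "V x = V y \<longleftrightarrow> x = y" for x y
    using assms(2) by (simp add: bij_is_inj inj_eq)
  have "(\<exists>w. w \<noteq> 0 \<and> T' w = c *s w) \<longleftrightarrow> (\<exists>v. v \<noteq> 0 \<and> T v = c *s v)" for c
  proof -
    \<comment> \<open>Surjectivity allows each candidate \<open>w\<close> to be written as
      \<open>V v\<close>.\<close>
    have "(\<exists>w. w \<noteq> 0 \<and> T' w = c *s w) \<longleftrightarrow> (\<exists>v. V v \<noteq> 0 \<and> T' (V v) = c *s V v)"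
      using assms(2) by (metis bij_is_surj surjD)
    also have "\<dots> \<longleftrightarrow> (\<exists>v. v \<noteq> 0 \<and> T v = c *s v)"
      by (metis TV V.scale V.zero inj)
    finally show ?thesis .
  qed
  then show ?thesis
    by (simp add: eigenvalues_def)
qed

theorem theorem3p1:
  fixes \<phi> \<psi> :: "nat \<Rightarrow> complex ^ 'm" and n :: nat
  assumes "is_frame n \<phi>"
    and "is_frame n \<psi>"
    and "unitary_equivalent n \<phi> \<psi>"
  shows "\<forall>r\<in>{1..n - 1}.
    max_spectral_error n r \<phi> (canonical_dual n \<phi>) = max_spectral_error n r \<psi> (canonical_dual n \<psi>)"
proof
  fix r
  obtain V where V: "unitary_operator V" and V\<phi>: "\<And>i. i \<in> {1..n} \<Longrightarrow> \<psi> i = V (\<phi> i)"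
    using assms(3) unfolding unitary_equivalent_def by metis
  \<comment> \<open>The restriction on \<open>\<Lambda>\<close> is there because \<open>V\<close> is
    known to match the two frames only on \<open>{1..n}\<close>.\<close>
  have "spectral_radius (error_op \<phi> (canonical_dual n \<phi>) \<Lambda>) =
      spectral_radius (error_op \<psi> (canonical_dual n \<psi>) \<Lambda>)" if "\<Lambda> \<subseteq> {1..n}" for \<Lambda>
  proof -
    have "error_op \<psi> (canonical_dual n \<psi>) \<Lambda> (V f) = V (error_op \<phi> (canonical_dual n \<phi>) \<Lambda> f)" for f
      using that
      by (intro error_op_unitary_operator[OF V] V\<phi>
          canonical_dual_unitary_operator[OF assms(1,2) V V\<phi>]) auto
    moreover have "Vector_Spaces.linear (*s) (*s) V"
      using V by (simp add: unitary_operator_def)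
    ultimately show ?thesis
      unfolding spectral_radius_def
      using eigenvalues_similar[OF _ bij_unitary_operator[OF V]] by metis
  qed
  then show "max_spectral_error n r \<phi> (canonical_dual n \<phi>) =
      max_spectral_error n r \<psi> (canonical_dual n \<psi>)"
    unfolding max_spectral_error_def by (intro arg_cong[where f = Max] image_cong) auto
qed

end
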